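(* Let $n_1,k_1,n_2,k_2$ be positive integers with $n_1k_2 = n_2k_1$. Assume that at least one of the following holds: (a) $n_1=n_2=n$, $k_1=k_2=k$ and $k = mn+\varepsilon$ for some $m\in\mathbb{N}$ and some $\varepsilon\in\{-2,-1,0,1,2\}$; (b) $k_1$ is divisible by $n_1$. Let $L_1,R_1,L_2,R_2$ be sets of sizes $n_1,k_1,n_2,k_2$, respectively, and let $(L_1,R_1,E_1,u_1,v_1)$ and $(L_2,R_2,E_2,u_2,v_2)$ be biregular bipartite labeled multigraphs with $|E_1|=|E_2|=n_1k_2$. Then there exists a bijection $\psi:E_1\to E_2$ such that $[u_2\circ\psi, v_1] = W_{L_2,R_1}$ and $[u_1\circ\psi^{-1}, v_2] = W_{L_1,R_2}$.
   Context: $\mathbb{N}=\{1,2,\dots\}$. A bipartite labeled multigraph is a tuple $(L,R,E,u,v)$ with $L,R,E$ finite sets (left part, right part, edge set; $L$ and $R$ may intersect) and functions $u:E\to L$, $v:E\to R$; it is biregular if all vertices of $L$ have the same degree ($|u^{-1}(x)|$ does not depend on $x\in L$) and all vertices of $R$ have the same degree ($|v^{-1}(y)|$ does not depend on $y\in R$). For functions $u:E\to L$, $v:E\to R$ with the same domain, $[u,v]$ denotes the $L\times R$ matrix whose $(x,y)$ entry is $|\{e\in E : u(e)=x,\ v(e)=y\}|$. $W_{L,R}$ is the $L\times R$ matrix with all entries equal to $1$. *)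

theory Defs
  imports Main "HOL-Library.FuncSet"
begin

locale bipartite_multigraph =
  fixes L :: "'l set" and R :: "'r set" and E :: "'e set"
    and u :: "'e \<Rightarrow> 'l" and v :: "'e \<Rightarrow> 'r"
  assumes finite_L: "finite L"
    and finite_R: "finite R"
    and finite_E: "finite E"
    and u_in: "u \<in> E \<rightarrow> L"
    and v_in: "v \<in> E \<rightarrow> R"

locale biregular_multigraph = bipartite_multigraph L R E u v
  for L :: "'l set" and R :: "'r set" and E :: "'e set"
    and u :: "'e \<Rightarrow> 'l" and v :: "'e \<Rightarrow> 'r" +
  assumes left_regular:
    "\<lbrakk>x \<in> L; x' \<in> L\<rbrakk> \<Longrightarrow> card {e \<in> E. u e = x} = card {e \<in> E. u e = x'}"
    and right_regular:
    "\<lbrakk>y \<in> R; y' \<in> R\<rbrakk> \<Longrightarrow> card {e \<in> E. v e = y} = card {e \<in> E. v e = y'}"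

text \<open>
  An \<open>L \<times> R\<close> matrix is an extensional function on \<open>L \<times> R\<close>, so that
  HOL equality of two such functions is entrywise equality over \<open>L \<times> R\<close>.
  The domain \<open>E\<close> of the functions \<open>u\<close> and \<open>v\<close> is an explicit argument.
\<close>

definition pair_matrix ::
  "'l set \<Rightarrow> 'r set \<Rightarrow> 'e set \<Rightarrow> ('e \<Rightarrow> 'l) \<Rightarrow> ('e \<Rightarrow> 'r) \<Rightarrow> 'l \<times> 'r \<Rightarrow> nat"
  where "pair_matrix L R E u v = (\<lambda>(x, y) \<in> L \<times> R. card {e \<in> E. u e = x \<and> v e = y})"

definition ones_matrix :: "'l set \<Rightarrow> 'r set \<Rightarrow> 'l \<times> 'r \<Rightarrow> nat"
  where "ones_matrix L R = (\<lambda>_ \<in> L \<times> R. 1)"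

end

theory Submission
  imports Defs "HOL-Combinatorics.Transposition"
begin

text \<open>
  Label every edge \<open>e\<close> of the first graph by \<open>u2 (\<psi> e) \<in> L2\<close> and every edge of the second graph by
  the \<open>u1\<close>-value of its preimage. The two matrix equations say exactly that these labels are edge
  colourings, with colour sets \<open>L2\<close> and \<open>L1\<close>, in which every right vertex sees each colour exactly
  once. Write \<open>load c x a\<close> for the number of edges of colour \<open>a\<close> at the left vertex \<open>x\<close>.
  Conversely, two such colourings \<open>p\<close> and \<open>q\<close> come from a bijection \<open>\<psi>\<close> as soon as their load
  matrices are transposes of each other, since then \<open>\<psi>\<close> can be chosen separately on each class
  \<open>u1 e = x, p e = z\<close> (lemma \<open>bijection_of_transposed_colorings\<close>). So it remains to
  colour the two graphs independently and to control the load matrices. Renaming the colours of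
  either colouring is free, so the load matrices only matter up to separate permutations of their
  rows and columns.

  The one tool is an exchange step (lemma \<open>exchange\<close>). For two colours \<open>a\<close> and \<open>b\<close>, every right
  vertex gives an arc from the left end of its \<open>a\<close>-edge to the left end of its \<open>b\<close>-edge. A vertex
  \<open>x\<close> with more \<open>a\<close> than \<open>b\<close> has a surplus of outgoing arcs, so a trail leads from \<open>x\<close> to a
  vertex \<open>x'\<close> with a surplus of incoming arcs; swapping the colours along the trail moves one unit
  of load at \<open>x\<close> from \<open>a\<close> to \<open>b\<close>, one unit at \<open>x'\<close> from \<open>b\<close> to \<open>a\<close>, and changes nothing else.

  A colouring that minimises the sum of the squared loads is therefore equitable: in each row
  of the load matrix the entries differ by at most one. If \<open>n1\<close> divides \<open>k1\<close>, all loads of both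
  colourings are equal to the quotient and the matrices are transposes of each other. Otherwise
  \<open>k = m n + \<epsilon>\<close> with \<open>0 < \<bar>\<epsilon>\<bar> < n\<close>, and the loads are \<open>m\<close>, except for exactly \<open>\<bar>\<epsilon>\<bar>\<close>
  marked entries in each row and column, which are \<open>m + sgn \<epsilon>\<close>. For \<open>\<bar>\<epsilon>\<bar> = 1\<close> the marked entries
  form a permutation matrix, and all of these agree up to permuting columns. For \<open>\<bar>\<epsilon>\<bar> = 2\<close> they
  form a 2-regular bipartite graph, a disjoint union of cycles. Here an exchange
  applied to columns from two different cycles merges the cycles, whichever \<open>x'\<close> comes out;
  hence a single cycle of full length can be reached in both graphs (lemma \<open>ex_single_cycle\<close>).
  In each case rows and columns can be enumerated so that the marked positions form a symmetric
  pattern depending on \<open>n\<close> and \<open>\<bar>\<epsilon>\<bar>\<close> alone, which makes the two matrices transposes of each other.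
\<close>

section \<open>Trails and balanced vectors\<close>

text \<open>
  Here \<open>s\<close> and \<open>t\<close> give the tail and the head of each arc in \<open>Y\<close>. A walk that starts at \<open>x\<close> and
  never reuses an arc can only get stuck at a vertex with more incoming than outgoing arcs.
  The conclusion on \<open>Y'\<close> records only what is used of the trail, its net effect on degrees.
  In the induction the first arc is removed, which passes the surplus of \<open>x\<close> on to
  the head of that arc.
\<close>

lemma trail_to_deficit:
  fixes s t :: "'y \<Rightarrow> 'l"
  assumes "finite Y" and "card {y \<in> Y. t y = x} < card {y \<in> Y. s y = x}"
  shows "\<exists>x' Y'. Y' \<subseteq> Y \<and> card {y \<in> Y. s y = x'} < card {y \<in> Y. t y = x'} \<and>
    (\<forall>z. int (card {y \<in> Y'. t y = z}) - int (card {y \<in> Y'. s y = z})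
           = of_bool (z = x') - of_bool (z = x))"
  using assms
proof (induction "card Y" arbitrary: x Y)
  case 0
  then show ?case by simp
next
  case (Suc k)
  have "card {y \<in> Y. s y = x} \<noteq> 0"
    using Suc.prems(2) by linarith
  then have "{y \<in> Y. s y = x} \<noteq> {}" by force
  then obtain y where y: "y \<in> Y" "s y = x" by blast
  define Z where "Z = Y - {y}"
  have Y: "Y = insert y Z" and nZ: "y \<notin> Z" and finZ: "finite Z" and kZ: "k = card Z"
    using y Suc by (auto simp: Z_def)
  have card_ins: "card {y' \<in> insert y A. h y' = z} = card {y' \<in> A. h y' = z} + of_bool (h y = z)"
    if "A \<subseteq> Z" for A :: "'y set" and h :: "'y \<Rightarrow> 'l" and z
  proof -
    have "{y' \<in> insert y A. h y' = z} = (if h y = z then insert y {y' \<in> A. h y' = z} else {y' \<in> A. h y' = z})"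
      by auto
    moreover have "finite A" "y \<notin> A" using that finZ nZ finite_subset by auto
    ultimately show ?thesis by auto
  qed
  show ?case
  proof (cases "card {y' \<in> Y. s y' = t y} < card {y' \<in> Y. t y' = t y}")
    case True
    have "int (card {y' \<in> {y}. t y' = z}) - int (card {y' \<in> {y}. s y' = z})
           = of_bool (z = t y) - of_bool (z = x)" for z
      using card_ins[of "{}" t z] card_ins[of "{}" s z] y by auto
    with True y show ?thesis by (intro exI[of _ "t y"] exI[of _ "{y}"]) auto
  next
    case False
    have "card {y' \<in> Z. t y' = t y} < card {y' \<in> Z. s y' = t y}"
      using False Suc.prems(2) card_ins[of Z t] card_ins[of Z s] y unfolding Y
      by (cases "t y = x") auto
    from Suc.hyps(1)[OF kZ finZ this] obtain x' Y' where
      Y': "Y' \<subseteq> Z" and x': "card {y' \<in> Z. s y' = x'} < card {y' \<in> Z. t y' = x'}"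
      and bal: "\<And>z. int (card {y' \<in> Y'. t y' = z}) - int (card {y' \<in> Y'. s y' = z})
           = of_bool (z = x') - of_bool (z = t y)" by blast
    \<comment> \<open>Removing a single arc cannot turn the outgoing surplus of \<open>x\<close> into an incoming one.\<close>
    have "x' \<noteq> x"
      using x' Suc.prems(2) card_ins[of Z t] card_ins[of Z s] y unfolding Y
      by (cases "t y = x") auto
    then have "card {y' \<in> Y. s y' = x'} < card {y' \<in> Y. t y' = x'}"
      using x' card_ins[of Z t] card_ins[of Z s] y unfolding Y by auto
    moreover have "int (card {y' \<in> insert y Y'. t y' = z}) - int (card {y' \<in> insert y Y'. s y' = z})
           = of_bool (z = x') - of_bool (z = x)" for z
      using bal[of z] card_ins[OF Y', of t z] card_ins[OF Y', of s z] y by auto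
    moreover have "insert y Y' \<subseteq> Y" using Y' Y by auto
    ultimately show ?thesis by (intro exI[of _ x'] exI[of _ "insert y Y'"] conjI allI)
  qed
qed

lemma balanced_zero_one:
  fixes g :: "'k \<Rightarrow> int"
  assumes fin: "finite K" and bal: "\<And>a b. a \<in> K \<Longrightarrow> b \<in> K \<Longrightarrow> g a \<le> g b + 1"
    and sum: "(\<Sum>a\<in>K. g a) = int r" and r: "r < card K" and a: "a \<in> K"
  shows "g a = 0 \<or> g a = 1"
proof (rule ccontr)
  assume "\<not> ?thesis"
  then consider "g a \<le> -1" | "g a \<ge> 2" by linarith
  then show False
  proof cases
    case 1
    have "(\<Sum>b\<in>K. g b) \<le> (\<Sum>b\<in>K. if b = a then -1 else 0)"
      using 1 bal[OF _ a] by (intro sum_mono) fastforce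
    also have "\<dots> = -1" using fin a by simp
    finally show False using sum by simp
  next
    case 2
    have "1 \<le> g b" if "b \<in> K" for b using 2 bal[OF a that] by linarith
    then have "(\<Sum>b\<in>K. 1) \<le> (\<Sum>b\<in>K. g b)" by (intro sum_mono)
    then show False using sum r by simp
  qed
qed

lemma ex_bij_fibrewise:
  assumes "finite A" "finite B"
    and fibres: "\<And>w. card {x \<in> A. h x = w} = card {y \<in> B. k y = w}"
  shows "\<exists>\<psi>. bij_betw \<psi> A B \<and> (\<forall>x\<in>A. k (\<psi> x) = h x)"
proof -
  have "\<exists>\<beta>. bij_betw \<beta> {x \<in> A. h x = w} {y \<in> B. k y = w}" for w
    using assms by (intro finite_same_card_bij) auto
  then obtain \<beta> where \<beta>: "\<And>w. bij_betw (\<beta> w) {x \<in> A. h x = w} {y \<in> B. k y = w}" by metis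
  define \<psi> where "\<psi> x = \<beta> (h x) x" for x
  have in_B: "\<psi> x \<in> B \<and> k (\<psi> x) = h x" if "x \<in> A" for x
    using bij_betw_apply[OF \<beta>[of "h x"], of x] that by (simp add: \<psi>_def)
  have "inj_on \<psi> A"
  proof (rule inj_onI)
    fix x y assume xy: "x \<in> A" "y \<in> A" "\<psi> x = \<psi> y"
    then have eq: "h x = h y" using in_B[of x] in_B[of y] by simp
    then have "\<beta> (h y) x = \<beta> (h y) y" using xy(3) by (simp add: \<psi>_def)
    then show "x = y" using bij_betw_imp_inj_on[OF \<beta>[of "h y"]] xy eq by (auto dest: inj_onD)
  qed
  moreover have "\<psi> ` A = B"
  proof
    show "\<psi> ` A \<subseteq> B" using in_B by auto
    show "B \<subseteq> \<psi> ` A"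
    proof
      fix y assume "y \<in> B"
      then have "y \<in> \<beta> (k y) ` {x \<in> A. h x = k y}" using bij_betw_imp_surj_on[OF \<beta>[of "k y"]] by simp
      then obtain x where "x \<in> A" "h x = k y" "y = \<beta> (k y) x" by auto
      then show "y \<in> \<psi> ` A" by (intro image_eqI[of _ _ x]) (simp_all add: \<psi>_def)
    qed
  qed
  ultimately show ?thesis using in_B by (auto simp: bij_betw_def)
qed

section \<open>Colourings in which every right vertex sees each colour once\<close>

locale right_regular_multigraph = bipartite_multigraph L R E u v
  for L :: "'l set" and R :: "'r set" and E :: "'e set"
    and u :: "'e \<Rightarrow> 'l" and v :: "'e \<Rightarrow> 'r" +
  fixes K :: "'k set"
  assumes finite_K: "finite K"
    and right_degree: "y \<in> R \<Longrightarrow> card {e \<in> E. v e = y} = card K"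
begin

definition right_proper :: "('e \<Rightarrow> 'k) \<Rightarrow> bool"
  where "right_proper c \<longleftrightarrow> (\<forall>y\<in>R. bij_betw c {e \<in> E. v e = y} K)"

definition load :: "('e \<Rightarrow> 'k) \<Rightarrow> 'l \<Rightarrow> 'k \<Rightarrow> nat"
  where "load c x a = card {e \<in> E. u e = x \<and> c e = a}"

lemma ex_right_proper: "\<exists>c. right_proper c"
proof -
  have "\<exists>h. bij_betw h {e \<in> E. v e = y} K" if "y \<in> R" for y
    using that by (intro finite_same_card_bij) (auto simp: finite_E finite_K right_degree)
  then obtain h where h: "\<And>y. y \<in> R \<Longrightarrow> bij_betw (h y) {e \<in> E. v e = y} K" by metis
  have "bij_betw (\<lambda>e. h (v e) e) {e \<in> E. v e = y} K" if "y \<in> R" for y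
    using h[OF that] by (subst bij_betw_cong[where g = "h y"]) auto
  then show ?thesis unfolding right_proper_def by blast
qed

lemma color_in:
  assumes "right_proper c" and "e \<in> E"
  shows "c e \<in> K"
proof -
  have "v e \<in> R" using v_in assms(2) by auto
  then have "bij_betw c {e' \<in> E. v e' = v e} K" using assms(1) by (simp add: right_proper_def)
  then show ?thesis by (rule bij_betw_apply) (simp add: assms(2))
qed

lemma color_inj:
  assumes "right_proper c" and "e \<in> E" "e' \<in> E" and "v e = v e'" and "c e = c e'"
  shows "e = e'"
proof -
  have "v e \<in> R" using v_in assms(2) by auto
  then have "inj_on c {e' \<in> E. v e' = v e}" using assms(1) by (simp add: right_proper_def bij_betw_def)
  then show ?thesis by (rule inj_onD) (use assms in auto)
qed

lemma ex_colored_edge: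
  assumes "right_proper c" and "y \<in> R" and "a \<in> K"
  obtains e where "e \<in> E" "v e = y" "c e = a"
proof -
  have "a \<in> c ` {e \<in> E. v e = y}"
    using assms by (simp add: right_proper_def bij_betw_def)
  then show thesis using that by blast
qed

lemma right_properI:
  assumes "\<And>e e'. \<lbrakk>e \<in> E; e' \<in> E; v e = v e'; c e = c e'\<rbrakk> \<Longrightarrow> e = e'"
    and "\<And>e. e \<in> E \<Longrightarrow> c e \<in> K"
  shows "right_proper c"
  unfolding right_proper_def
proof
  fix y assume y: "y \<in> R"
  have inj: "inj_on c {e \<in> E. v e = y}" using assms(1) by (auto intro!: inj_onI)
  have "c ` {e \<in> E. v e = y} = K"
    using assms(2) by (intro card_subset_eq finite_K) (auto simp: card_image[OF inj] right_degree[OF y])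
  with inj show "bij_betw c {e \<in> E. v e = y} K" by (simp add: bij_betw_def)
qed

text \<open>
  Choosing at each right vertex its unique edge of colour \<open>d\<close> turns the loads of that
  colour into degrees of a graph whose arcs are the right vertices.
\<close>

lemma load_eq_card_right:
  assumes "right_proper c"
    and "\<And>y. y \<in> R \<Longrightarrow> g y \<in> E \<and> v (g y) = y \<and> c (g y) = d"
  shows "load c x d = card {y \<in> R. u (g y) = x}"
proof -
  have "{e \<in> E. u e = x \<and> c e = d} = g ` {y \<in> R. u (g y) = x}"
  proof (intro equalityI subsetI)
    fix e assume e: "e \<in> {e \<in> E. u e = x \<and> c e = d}"
    then have "v e \<in> R" using v_in by auto
    then have "g (v e) = e" using e assms(2)[of "v e"] color_inj[OF assms(1), of "g (v e)" e] by auto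
    with e \<open>v e \<in> R\<close> show "e \<in> g ` {y \<in> R. u (g y) = x}"
      by (auto intro!: image_eqI[of _ _ "v e"])
  qed (use assms(2) in auto)
  moreover have "inj_on g {y \<in> R. u (g y) = x}"
    by (rule inj_on_inverseI[of _ v]) (use assms(2) in simp)
  ultimately show ?thesis by (simp add: load_def card_image)
qed

text \<open>
  The right vertices along a trail swap their edges of colours \<open>a\<close> and \<open>b\<close>. Which \<open>x'\<close> the trail
  ends in cannot be prescribed; every use of this lemma has to cope with all of them.
\<close>

lemma exchange:
  assumes c: "right_proper c" and a: "a \<in> K" and b: "b \<in> K" and gt: "load c x b < load c x a"
  shows "\<exists>x' c'. right_proper c' \<and> x' \<in> L \<and> load c x' a < load c x' b \<and>
    (\<forall>z d. int (load c' z d) = int (load c z d)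
        + (of_bool (z = x') - of_bool (z = x)) * (of_bool (d = a) - of_bool (d = b)))"
proof -
  have ab: "a \<noteq> b" using gt by auto
  have "\<exists>e. e \<in> E \<and> v e = y \<and> c e = d" if "y \<in> R" "d \<in> K" for y d
    using ex_colored_edge[OF c that] by blast
  then have ex: "\<forall>p\<in>K \<times> R. \<exists>e. e \<in> E \<and> v e = snd p \<and> c e = fst p" by auto
  obtain h where h: "\<forall>p\<in>K \<times> R. h p \<in> E \<and> v (h p) = snd p \<and> c (h p) = fst p"
    using bchoice[OF ex] by blast
  define edge where "edge d y = h (d, y)" for d y
  have edge: "edge d y \<in> E \<and> v (edge d y) = y \<and> c (edge d y) = d" if "y \<in> R" "d \<in> K" for y d
    using bspec[OF h, of "(d, y)"] that by (simp add: edge_def)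
  define s where "s y = u (edge a y)" for y
  define t where "t y = u (edge b y)" for y
  have la: "load c z a = card {y \<in> R. s y = z}" and lb: "load c z b = card {y \<in> R. t y = z}" for z
    unfolding s_def t_def by (intro load_eq_card_right c edge; use a b in simp)+
  have "card {y \<in> R. t y = x} < card {y \<in> R. s y = x}" using gt by (simp add: la lb)
  from trail_to_deficit[OF finite_R this]
  obtain x' Y where Y: "Y \<subseteq> R" and x': "card {y \<in> R. s y = x'} < card {y \<in> R. t y = x'}"
    and bal: "\<And>z. int (card {y \<in> Y. t y = z}) - int (card {y \<in> Y. s y = z})
           = of_bool (z = x') - of_bool (z = x)"
    by blast
  define c' where "c' e = (if v e \<in> Y then transpose a b (c e) else c e)" for e
  have c': "right_proper c'"
  proof (rule right_properI)
    fix e e' assume "e \<in> E" "e' \<in> E" "v e = v e'" "c' e = c' e'"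
    then show "e = e'" using color_inj[OF c, of e e'] by (auto simp: c'_def split: if_splits dest: injD[OF inj_transpose])
  next
    fix e assume "e \<in> E"
    then show "c' e \<in> K" using color_in[OF c, of e] a b by (auto simp: c'_def transpose_def)
  qed
  have la': "load c' z a = card {y \<in> R. (if y \<in> Y then t y else s y) = z}" for z
    using load_eq_card_right[OF c', of "\<lambda>y. if y \<in> Y then edge b y else edge a y" a z] edge a b
    by (auto simp: c'_def s_def t_def if_distrib)
  have lb': "load c' z b = card {y \<in> R. (if y \<in> Y then s y else t y) = z}" for z
    using load_eq_card_right[OF c', of "\<lambda>y. if y \<in> Y then edge a y else edge b y" b z] edge a b
    by (auto simp: c'_def s_def t_def if_distrib)
  have split: "card {y \<in> R. (if y \<in> Y then g y else h y) = z}
      = card {y \<in> Y. g y = z} + card {y \<in> R - Y. h y = z}" for g h :: "'r \<Rightarrow> 'l" and z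
  proof -
    have "{y \<in> R. (if y \<in> Y then g y else h y) = z} = {y \<in> Y. g y = z} \<union> {y \<in> R - Y. h y = z}"
      using Y by auto
    moreover have "finite Y" using Y finite_R finite_subset by blast
    ultimately show ?thesis using finite_R by (simp add: card_Un_disjoint disjoint_iff)
  qed
  have "int (load c' z d) = int (load c z d)
        + (of_bool (z = x') - of_bool (z = x)) * (of_bool (d = a) - of_bool (d = b))" for z d
  proof -
    consider "d = a" | "d = b" | "d \<noteq> a" "d \<noteq> b" by blast
    then show ?thesis
    proof cases
      case 1
      then show ?thesis using ab bal[of z] la la' split[of t s z] split[of s s z] by simp
    next
      case 2
      then show ?thesis using ab bal[of z] lb lb' split[of s t z] split[of t t z] by simp
    next
      case 3
      then have "c' e = d \<longleftrightarrow> c e = d" for e by (auto simp: c'_def transpose_def)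
      with 3 show ?thesis by (simp add: load_def)
    qed
  qed
  moreover have "x' \<in> L"
  proof -
    have "load c x' b \<noteq> 0" using x' la lb by simp
    then have "{e \<in> E. u e = x' \<and> c e = b} \<noteq> {}" unfolding load_def by force
    then show ?thesis using u_in by auto
  qed
  ultimately show ?thesis using c' x'
    by (intro exI[of _ x'] exI[of _ c'] conjI allI) (simp_all only: la lb)
qed

lemma row_sum:
  assumes "right_proper c"
  shows "(\<Sum>a\<in>K. load c x a) = card {e \<in> E. u e = x}"
proof -
  have "card {e \<in> E. u e = x} = card (\<Union>a\<in>K. {e \<in> E. u e = x \<and> c e = a})"
    using color_in[OF assms] by (intro arg_cong[of _ _ card]) auto
  also have "\<dots> = (\<Sum>a\<in>K. load c x a)"
    unfolding load_def by (intro card_UN_disjoint finite_K) (auto simp: finite_E)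
  finally show ?thesis by simp
qed

lemma column_sum:
  assumes c: "right_proper c" and a: "a \<in> K"
  shows "(\<Sum>x\<in>L. load c x a) = card R"
proof -
  have "(\<Sum>x\<in>L. load c x a) = card (\<Union>x\<in>L. {e \<in> E. u e = x \<and> c e = a})"
    unfolding load_def by (intro card_UN_disjoint[symmetric] finite_L) (auto simp: finite_E)
  also have "\<dots> = card {e \<in> E. c e = a}"
    using u_in by (intro arg_cong[of _ _ card]) auto
  also have "\<dots> = card R"
  proof (rule bij_betw_same_card[of v], unfold bij_betw_def, intro conjI)
    show "inj_on v {e \<in> E. c e = a}" using color_inj[OF c] by (auto intro!: inj_onI)
    show "v ` {e \<in> E. c e = a} = R"
    proof
      show "v ` {e \<in> E. c e = a} \<subseteq> R" using v_in by auto
      show "R \<subseteq> v ` {e \<in> E. c e = a}"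
      proof
        fix y assume "y \<in> R"
        then obtain e where "e \<in> E" "v e = y" "c e = a" using ex_colored_edge[OF c _ a] by blast
        then show "y \<in> v ` {e \<in> E. c e = a}" by blast
      qed
    qed
  qed
  finally show ?thesis .
qed

text \<open>
  If some row had entries differing by two or more, an exchange would decrease the sum of the
  squared loads: the row of \<open>x\<close> loses at least 2, and the row of \<open>x'\<close>, where \<open>b\<close> was more
  frequent than \<open>a\<close>, does not gain.
\<close>

lemma ex_equitable:
  "\<exists>c. right_proper c \<and> (\<forall>x\<in>L. \<forall>a\<in>K. \<forall>b\<in>K. load c x a \<le> load c x b + 1)"
proof -
  define \<Phi> where "\<Phi> c = (\<Sum>z\<in>L. \<Sum>d\<in>K. (int (load c z d))\<^sup>2)" for c
  have nonneg: "\<Phi> c \<ge> 0" for c unfolding \<Phi>_def by (intro sum_nonneg) auto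
  obtain c0 where "right_proper c0" using ex_right_proper by blast
  from ex_has_least_nat[of right_proper, OF this, of "\<lambda>c. nat (\<Phi> c)"]
  obtain c where c: "right_proper c" and least: "\<And>c'. right_proper c' \<Longrightarrow> nat (\<Phi> c) \<le> nat (\<Phi> c')"
    by blast
  have min: "\<Phi> c \<le> \<Phi> c'" if "right_proper c'" for c'
    using least[OF that] nonneg[of c] nonneg[of c'] by linarith
  have "load c x a \<le> load c x b + 1" if x: "x \<in> L" and a: "a \<in> K" and b: "b \<in> K" for x a b
  proof (rule ccontr)
    assume "\<not> ?thesis"
    then have gt: "load c x b + 1 < load c x a" by simp
    obtain x' c' where c': "right_proper c'" and x': "x' \<in> L" "load c x' a < load c x' b"
      and upd: "\<And>z d. int (load c' z d) = int (load c z d)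
        + (of_bool (z = x') - of_bool (z = x)) * (of_bool (d = a) - of_bool (d = b))"
      using exchange[OF c a b, of x] gt by auto
    have ne: "x' \<noteq> x" "a \<noteq> b" using x' gt by auto
    have fin: "finite L" "finite K" using finite_L finite_K .
    \<comment> \<open>In this form the change is a sum of products of an indicator of \<open>z\<close> with one of \<open>d\<close>, over which the double sum collapses.\<close>
    have sq: "(int (load c' z d))\<^sup>2 = (int (load c z d))\<^sup>2
       + (of_bool (z = x') - of_bool (z = x))
           * (of_bool (d = a) * (2 * int (load c z a)) - of_bool (d = b) * (2 * int (load c z b)))
       + (of_bool (z = x') + of_bool (z = x)) * (of_bool (d = a) + of_bool (d = b))" for z d
    proof -
      define \<alpha> \<beta> :: int where "\<alpha> = of_bool (z = x') - of_bool (z = x)" and "\<beta> = of_bool (d = a) - of_bool (d = b)"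
      have "\<alpha>\<^sup>2 = of_bool (z = x') + of_bool (z = x)" "\<beta>\<^sup>2 = of_bool (d = a) + of_bool (d = b)"
        using ne by (simp_all add: \<alpha>_def \<beta>_def of_bool_def)
      moreover have "2 * int (load c z d) * \<beta> = of_bool (d = a) * (2 * int (load c z a)) - of_bool (d = b) * (2 * int (load c z b))"
        using ne by (simp add: \<beta>_def of_bool_def)
      moreover have "(int (load c' z d))\<^sup>2 = (int (load c z d))\<^sup>2 + \<alpha> * (2 * int (load c z d) * \<beta>) + \<alpha>\<^sup>2 * \<beta>\<^sup>2"
        unfolding upd \<alpha>_def[symmetric] \<beta>_def[symmetric] by (simp add: power2_eq_square algebra_simps)
      ultimately show ?thesis by (simp only: \<alpha>_def)
    qed
    have "\<Phi> c' = \<Phi> c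
       + (\<Sum>z\<in>L. (of_bool (z = x') - of_bool (z = x)) * (2 * int (load c z a) - 2 * int (load c z b)))
       + (\<Sum>z\<in>L. (of_bool (z = x') + of_bool (z = x)) * 2)"
      unfolding \<Phi>_def sq sum.distrib sum_distrib_left[symmetric] sum_subtractf
      using a b fin by simp
    also have "\<dots> = \<Phi> c + (2 * int (load c x' a) - 2 * int (load c x' b))
       - (2 * int (load c x a) - 2 * int (load c x b)) + 4"
      unfolding left_diff_distrib distrib_right sum.distrib sum_subtractf using x x' fin by simp
    also have "\<dots> < \<Phi> c" using x'(2) gt by linarith
    finally show False using min[OF c'] by simp
  qed
  with c show ?thesis by blast
qed

lemma pair_matrix_right_proper:
  assumes "right_proper c"
  shows "pair_matrix K R E c v = ones_matrix K R"
proof -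
  have "card {e \<in> E. c e = a \<and> v e = y} = 1" if a: "a \<in> K" and y: "y \<in> R" for a y
  proof -
    obtain e where e: "e \<in> E" "v e = y" "c e = a" using ex_colored_edge[OF assms y a] .
    have "{e \<in> E. c e = a \<and> v e = y} = {e}"
    proof (intro equalityI subsetI)
      fix e' assume "e' \<in> {e \<in> E. c e = a \<and> v e = y}"
      then show "e' \<in> {e}" using color_inj[OF assms, of e' e] e by simp
    qed (use e in simp)
    then show ?thesis by simp
  qed
  then show ?thesis unfolding pair_matrix_def ones_matrix_def by (intro restrict_ext) auto
qed

lemma right_proper_recolor:
  assumes "right_proper c" and "bij_betw h K K"
  shows "right_proper (h \<circ> c)"
  using assms by (auto simp: right_proper_def intro: bij_betw_trans)

lemma load_recolor:
  assumes c: "right_proper c" and h: "bij_betw h K K" and a: "a \<in> K"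
  shows "load (h \<circ> c) x (h a) = load c x a"
proof -
  have "h (c e) = h a \<longleftrightarrow> c e = a" if "e \<in> E" for e
    using bij_betw_imp_inj_on[OF h] color_in[OF c that] a by (auto dest: inj_onD)
  then show ?thesis by (simp add: load_def cong: conj_cong)
qed

end

section \<open>Making a 2-regular relation a single cycle\<close>

text \<open>
  The relation \<open>M\<close> is viewed as a bipartite graph with vertex classes \<open>L\<close> and \<open>K\<close>. The path
  begins and ends in \<open>L\<close>.
\<close>

definition alternating_path ::
  "'l set \<Rightarrow> 'k set \<Rightarrow> ('l \<Rightarrow> 'k \<Rightarrow> bool) \<Rightarrow> 'l list \<Rightarrow> 'k list \<Rightarrow> bool"
  where "alternating_path L K M xs as \<longleftrightarrow>
    length xs = Suc (length as) \<and> distinct xs \<and> distinct as \<and> set xs \<subseteq> L \<and> set as \<subseteq> K \<and>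
    (\<forall>i<length as. M (xs ! i) (as ! i) \<and> M (xs ! Suc i) (as ! i))"

definition two_regular :: "'l set \<Rightarrow> 'k set \<Rightarrow> ('l \<Rightarrow> 'k \<Rightarrow> bool) \<Rightarrow> bool"
  where "two_regular L K M \<longleftrightarrow>
    (\<forall>x\<in>L. card {a \<in> K. M x a} = 2) \<and> (\<forall>a\<in>K. card {x \<in> L. M x a} = 2)"

text \<open>
  The effect of an exchange on marked entries: \<open>x\<close> trades \<open>a\<close> for \<open>b\<close> while \<open>x'\<close> trades \<open>b\<close> for \<open>a\<close>.
\<close>

definition switch :: "('l \<Rightarrow> 'k \<Rightarrow> bool) \<Rightarrow> 'l \<Rightarrow> 'k \<Rightarrow> 'l \<Rightarrow> 'k \<Rightarrow> 'l \<Rightarrow> 'k \<Rightarrow> bool"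
  where "switch M x a x' b = (\<lambda>z d.
    if d = a then z = x' \<or> M z a \<and> z \<noteq> x
    else if d = b then z = x \<or> M z b \<and> z \<noteq> x'
    else M z d)"

lemma card_2_eq_pair:
  assumes "card A = 2" "x \<in> A" "y \<in> A" "x \<noteq> y"
  shows "A = {x, y}"
proof -
  have "finite A" using assms(1) card.infinite by force
  then show ?thesis using assms by (intro card_subset_eq[symmetric]) auto
qed

lemma alternating_path_append:
  assumes p: "alternating_path L K M xs as" and "w \<in> L" "w \<notin> set xs" "d \<in> K" "d \<notin> set as"
    and "M (xs ! length as) d" "M w d"
  shows "alternating_path L K M (xs @ [w]) (as @ [d])"
  using assms unfolding alternating_path_def by (auto simp: nth_append less_Suc_eq)

lemma alternating_path_prepend:
  assumes p: "alternating_path L K M xs as" and "w \<in> L" "w \<notin> set xs" "d \<in> K" "d \<notin> set as"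
    and "M (xs ! 0) d" "M w d"
  shows "alternating_path L K M (w # xs) (d # as)"
  using assms unfolding alternating_path_def by (auto simp: nth_Cons split: nat.split)

lemma alternating_path_column:
  assumes "alternating_path L K M xs as" "two_regular L K M" "i < length as" "z \<in> L"
  shows "M z (as ! i) \<longleftrightarrow> z = xs ! i \<or> z = xs ! Suc i"
proof -
  have "as ! i \<in> K" "xs ! i \<in> L" "xs ! Suc i \<in> L" "xs ! i \<noteq> xs ! Suc i"
    using assms by (auto simp: alternating_path_def nth_eq_iff_index_eq subset_iff)
  then have "{z \<in> L. M z (as ! i)} = {xs ! i, xs ! Suc i}"
    using assms by (intro card_2_eq_pair) (auto simp: alternating_path_def two_regular_def)
  then show ?thesis using assms(4) by blast
qed

lemma alternating_path_end:
  assumes p: "alternating_path L K M xs as" and reg: "two_regular L K M"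
    and e: "e = 0 \<or> e = length as"
  shows "\<exists>b\<in>K - set as. M (xs ! e) b"
proof (rule ccontr)
  assume no: "\<not> ?thesis"
  have eL: "xs ! e \<in> L" using p e by (auto simp: alternating_path_def subset_iff)
  have len: "length xs = Suc (length as)" and dist: "distinct xs"
    using p by (auto simp: alternating_path_def)
  have "{a \<in> K. M (xs ! e) a} \<subseteq> {as ! (if e = 0 then 0 else length as - 1)}"
  proof
    fix a assume a: "a \<in> {a \<in> K. M (xs ! e) a}"
    then have "a \<in> set as" using no by blast
    then obtain j where j: "j < length as" "a = as ! j" by (auto simp: in_set_conv_nth)
    have "xs ! e = xs ! j \<or> xs ! e = xs ! Suc j"
      using a alternating_path_column[OF p reg j(1) eL] j(2) by simp
    then have "e = j \<or> e = Suc j"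
      using j e len dist by (auto simp: nth_eq_iff_index_eq)
    then have "j = (if e = 0 then 0 else length as - 1)" using j(1) e by auto
    then show "a \<in> {as ! (if e = 0 then 0 else length as - 1)}" using j(2) by simp
  qed
  then have "card {a \<in> K. M (xs ! e) a} \<le> 1"
    using card_mono[of "{as ! (if e = 0 then 0 else length as - 1)}"] by simp
  then show False using reg eL by (simp add: two_regular_def)
qed

lemma alternating_path_interior:
  assumes p: "alternating_path L K M xs as" and reg: "two_regular L K M"
    and i: "0 < i" "i < length as" and d: "d \<in> K" "d \<notin> set as"
  shows "\<not> M (xs ! i) d"
proof
  assume Md: "M (xs ! i) d"
  have iL: "xs ! i \<in> L" using p i by (auto simp: alternating_path_def subset_iff)
  have as: "as ! (i - 1) \<in> set as" "as ! i \<in> set as" "as ! (i - 1) \<noteq> as ! i"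
    using p i by (auto simp: alternating_path_def nth_eq_iff_index_eq)
  have M: "M (xs ! i) (as ! (i - 1))" "M (xs ! i) (as ! i)"
    using alternating_path_column[OF p reg _ iL] i by auto
  have "set as \<subseteq> K" using p by (simp add: alternating_path_def)
  then have eq: "{a \<in> K. M (xs ! i) a} = {as ! (i - 1), as ! i}"
    using as M reg iL by (intro card_2_eq_pair) (auto simp: two_regular_def)
  have "d \<in> {as ! (i - 1), as ! i}" unfolding eq[symmetric] using d Md by simp
  then show False using d(2) as by auto
qed

text \<open>
  An alternating path of maximal length, over all relations satisfying \<open>P\<close>, visits all of \<open>L\<close>.
  Suppose it misses \<open>w\<close>, and let \<open>d\<close> be a column of \<open>w\<close>. No vertex of the path lies in column
  \<open>d\<close>: both columns of an inner vertex are used by the path, and from an end vertex the path would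
  extend through \<open>d\<close> to \<open>w\<close>. Switch the last vertex
  of the path from its free column \<open>b\<close> to \<open>d\<close>. This leaves the columns of the path alone, and whatever
  vertex leaves column \<open>d\<close> in return, the other vertex of \<open>d\<close> is still there and
  off the path, so it extends the path after the switch. This contradicts maximality.
\<close>

lemma ex_single_cycle:
  fixes P :: "('l \<Rightarrow> 'k \<Rightarrow> bool) \<Rightarrow> bool"
  assumes finL: "finite L" and finK: "finite K" and cards: "card L = n" "card K = n" and n: "n \<ge> 3"
    and P0: "P M0" and reg: "\<And>M. P M \<Longrightarrow> two_regular L K M"
    and switch: "\<And>M x a b. \<lbrakk>P M; x \<in> L; a \<in> K; b \<in> K; M x a; \<not> M x b\<rbrakk>
      \<Longrightarrow> \<exists>x'\<in>L. \<not> M x' a \<and> M x' b \<and> P (switch M x a x' b)"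
  shows "\<exists>M f g. P M \<and> bij_betw f {..<n} L \<and> bij_betw g {..<n} K \<and>
    (\<forall>i<n. \<forall>j<n. M (f i) (g j) \<longleftrightarrow> i = j \<or> i = Suc j mod n)"
proof -
  define S where "S = (\<lambda>(M, xs, as). P M \<and> alternating_path L K M xs as)"
  have "L \<noteq> {}" using cards n by auto
  then obtain x0 where "x0 \<in> L" by blast
  then have S0: "S (M0, [x0], [])" using P0 by (auto simp: S_def alternating_path_def)
  have bound: "length as < Suc n" if "S (M, xs, as)" for M xs as
  proof -
    have as: "distinct as" "set as \<subseteq> K" using that by (auto simp: S_def alternating_path_def)
    show ?thesis using card_mono[OF finK as(2)] distinct_card[OF as(1)] cards by simp
  qed
  have "\<exists>q. S q \<and> (\<forall>q'. S q' \<longrightarrow> length (snd (snd q')) \<le> length (snd (snd q)))"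
    by (rule ex_has_greatest_nat[of S "(M0, [x0], [])" _ "Suc n"]) (use S0 bound in auto)
  then obtain M xs as where S: "S (M, xs, as)"
    and max: "\<And>M' xs' as'. S (M', xs', as') \<Longrightarrow> length as' \<le> length as" by auto
  have PM: "P M" and p: "alternating_path L K M xs as" using S by (auto simp: S_def)
  note reg_M = reg[OF PM]
  define t where "t = length as"
  have len: "length xs = Suc t" "length as = t" and dist: "distinct xs" "distinct as"
    and sub: "set xs \<subseteq> L" "set as \<subseteq> K"
    using p by (auto simp: alternating_path_def t_def)
  have setxs: "set xs = L"
  proof (rule ccontr)
    assume "set xs \<noteq> L"
    then obtain w where w: "w \<in> L" "w \<notin> set xs" using sub by blast
    have off_path: "\<not> M y d" if "w' \<in> L" "w' \<notin> set xs" "d \<in> K" "M w' d" and y: "y \<in> set xs" for w' d y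
    proof
      assume yd: "M y d"
      have d: "d \<notin> set as"
      proof
        assume "d \<in> set as"
        then obtain i where i: "i < length as" "d = as ! i" by (auto simp: in_set_conv_nth)
        then have "w' = xs ! i \<or> w' = xs ! Suc i"
          using alternating_path_column[OF p reg_M i(1) that(1)] that(4) by simp
        then show False using that(2) i len by auto
      qed
      obtain i where i: "i \<le> t" "y = xs ! i" using y len by (auto simp: in_set_conv_nth less_Suc_eq_le)
      consider "i = 0" | "i = t" | "0 < i" "i < t" using i by linarith
      then show False
      proof cases
        case 1
        then have "alternating_path L K M (w' # xs) (d # as)"
          using alternating_path_prepend[of L K M xs as w' d] p that y d yd i by simp
        then have "length (d # as) \<le> length as" using PM by (intro max) (simp add: S_def)
        then show False by simp
      next
        case 2
        then have "alternating_path L K M (xs @ [w']) (as @ [d])"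
          using alternating_path_append[of L K M xs as w' d] p that y d yd i len by simp
        then have "length (as @ [d]) \<le> length as" using PM by (intro max) (simp add: S_def)
        then show False by simp
      next
        case 3
        then show False using alternating_path_interior[OF p reg_M] that y d yd i len by blast
      qed
    qed
    define x where "x = xs ! t"
    have x: "x \<in> L" "x \<in> set xs" using len sub by (auto simp: x_def)
    obtain b where b: "b \<in> K" "b \<notin> set as" "M x b"
      using alternating_path_end[OF p reg_M, of t] len by (auto simp: x_def)
    have "card {d \<in> K. M w d} = 2" using reg_M w by (simp add: two_regular_def)
    then have "{d \<in> K. M w d} \<noteq> {}" by force
    then obtain d where d: "d \<in> K" "M w d" by blast
    have dx: "\<not> M y d" if "y \<in> set xs" for y using off_path[OF w d that] .
    have das: "d \<notin> set as"
    proof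
      assume "d \<in> set as"
      then obtain i where "i < length as" "d = as ! i" by (auto simp: in_set_conv_nth)
      then show False using dx[of "xs ! i"] p len by (auto simp: alternating_path_def)
    qed
    obtain x' where x': "x' \<in> L" "\<not> M x' b" "M x' d" and PM': "P (switch M x b x' d)"
      using switch[OF PM x(1) b(1) d(1) b(3)] dx[OF x(2)] by blast
    have bd: "b \<noteq> d" using b(3) dx[OF x(2)] by auto
    have "card {z \<in> L. M z d} = 2" using reg_M d by (simp add: two_regular_def)
    then have "\<not> {z \<in> L. M z d} \<subseteq> {x'}"
      using card_mono[of "{x'}" "{z \<in> L. M z d}"] by auto
    then obtain z where z: "z \<in> L" "M z d" "z \<noteq> x'" by blast
    have zxs: "z \<notin> set xs" using dx z by blast
    have "alternating_path L K (switch M x b x' d) xs as"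
    proof -
      have "as ! i \<noteq> b \<and> as ! i \<noteq> d" if "i < length as" for i
        using nth_mem[OF that] b das by auto
      then show ?thesis using p by (simp add: alternating_path_def switch_def)
    qed
    then have "alternating_path L K (switch M x b x' d) (xs @ [z]) (as @ [d])"
      using z zxs d das bd len by (intro alternating_path_append) (auto simp: switch_def x_def)
    then have "length (as @ [d]) \<le> length as" using PM' by (intro max) (simp add: S_def)
    then show False by simp
  qed
  \<comment> \<open>The path visits \<open>n\<close> vertices through \<open>n - 1\<close> columns; the remaining column \<open>b\<close> joins its two ends.\<close>
  then have tn: "Suc t = n" using distinct_card[OF dist(1)] len cards by simp
  obtain b where b: "b \<in> K" "b \<notin> set as" "M (xs ! t) b"
    using alternating_path_end[OF p reg_M, of t] len by auto
  have K: "insert b (set as) = K"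
  proof (rule card_subset_eq[OF finK])
    show "card (insert b (set as)) = card K"
      using b(2) distinct_card[OF dist(2)] len tn cards by simp
  qed (use b sub in auto)
  obtain b' where "b' \<in> K - set as" "M (xs ! 0) b'"
    using alternating_path_end[OF p reg_M, of 0] by auto
  then have b0: "M (xs ! 0) b" using K by auto
  have col_b: "M z b \<longleftrightarrow> z = xs ! 0 \<or> z = xs ! t" if "z \<in> L" for z
  proof -
    have "xs ! 0 \<noteq> xs ! t" using dist len tn n by (simp add: nth_eq_iff_index_eq)
    then have "{z \<in> L. M z b} = {xs ! 0, xs ! t}"
      using b b0 reg_M sub len by (intro card_2_eq_pair) (auto simp: two_regular_def)
    then show ?thesis using that by blast
  qed
  define as' where "as' = as @ [b]"
  have as': "distinct as'" "set as' = K" "length as' = n"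
    using dist b K len tn by (auto simp: as'_def)
  have "bij_betw ((!) xs) {..<n} L" "bij_betw ((!) as') {..<n} K"
    using bij_betw_nth[OF dist(1)] bij_betw_nth[OF as'(1)] len tn setxs as' by auto
  moreover have "M (xs ! i) (as' ! j) \<longleftrightarrow> i = j \<or> i = Suc j mod n" if "i < n" "j < n" for i j
  proof -
    have iL: "xs ! i \<in> L" using that len tn sub by auto
    show ?thesis
    proof (cases "j < t")
      case True
      then show ?thesis
        using alternating_path_column[OF p reg_M _ iL, of j] that len tn dist
        by (auto simp: as'_def nth_append nth_eq_iff_index_eq)
    next
      case False
      then have "j = t" using that tn by simp
      then show ?thesis
        using col_b[OF iL] that len tn dist by (auto simp: as'_def nth_append nth_eq_iff_index_eq)
    qed
  qed
  ultimately show ?thesis using PM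
    by (intro exI[of _ M] exI[of _ "(!) xs"] exI[of _ "(!) as'"]) auto
qed

text \<open>The analogue for a relation that is the graph of a bijection, where nothing has to be switched.\<close>

lemma ex_diagonal_enumeration:
  assumes finL: "finite L" and finK: "finite K" and cards: "card L = n" "card K = n"
    and rows: "\<And>x. x \<in> L \<Longrightarrow> card {a \<in> K. M x a} = 1"
    and cols: "\<And>a. a \<in> K \<Longrightarrow> card {x \<in> L. M x a} = 1"
  shows "\<exists>f g. bij_betw f {..<n} L \<and> bij_betw g {..<n} K \<and>
    (\<forall>i<n. \<forall>j<n. M (f i) (g j) \<longleftrightarrow> i = j)"
proof -
  obtain f where f: "bij_betw f {..<n} L"
    using finite_same_card_bij[of "{..<n}" L] finL cards by auto
  have "\<forall>x\<in>L. \<exists>a. {a \<in> K. M x a} = {a}"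
    using rows by (simp add: card_1_singleton_iff)
  from bchoice[OF this] obtain p where p: "\<forall>x\<in>L. {a \<in> K. M x a} = {p x}" by (elim exE)
  have pM: "M x a \<longleftrightarrow> a = p x" if "x \<in> L" "a \<in> K" for x a
    using bspec[OF p that(1)] that(2) by auto
  have pK: "p x \<in> K" if "x \<in> L" for x using bspec[OF p that] by auto
  have inj: "inj_on p L"
  proof (rule inj_onI)
    fix x y assume xy: "x \<in> L" "y \<in> L" "p x = p y"
    obtain w where w: "{z \<in> L. M z (p x)} = {w}"
      using cols[OF pK[OF xy(1)]] by (auto simp: card_1_singleton_iff)
    have "x \<in> {z \<in> L. M z (p x)}" "y \<in> {z \<in> L. M z (p x)}"
      using xy pM pK by simp_all
    then show "x = y" unfolding w by simp
  qed
  then have "p ` L = K"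
    using pK cards by (intro card_subset_eq finK) (auto simp: card_image)
  then have "bij_betw p L K" using inj by (simp add: bij_betw_def)
  with f have "bij_betw (p \<circ> f) {..<n} K" by (rule bij_betw_trans)
  moreover have "M (f i) ((p \<circ> f) j) \<longleftrightarrow> i = j" if "i < n" "j < n" for i j
  proof -
    have fL: "f i \<in> L" "f j \<in> L" using bij_betw_apply[OF f] that by simp_all
    have "M (f i) (p (f j)) \<longleftrightarrow> p (f j) = p (f i)" using pM[OF fL(1) pK[OF fL(2)]] .
    also have "\<dots> \<longleftrightarrow> i = j"
      using inj_onD[OF inj _ fL(2) fL(1)] inj_onD[OF bij_betw_imp_inj_on[OF f]] that by auto
    finally show ?thesis by simp
  qed
  ultimately show ?thesis using f by (intro exI[of _ f] exI[of _ "p \<circ> f"]) simp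
qed

section \<open>A normal form for the load matrix\<close>

text \<open>
  The common pattern of marked entries in both graphs. For two marks per row it says that \<open>i + j\<close>
  is congruent to \<open>-1\<close> or \<open>-2\<close> modulo \<open>n\<close>: this is the \<open>2n\<close>-cycle, with the rows numbered backwards
  relative to the columns. The reversal is what makes the pattern symmetric in \<open>i\<close> and \<open>j\<close>.
\<close>

definition symmetric_pattern :: "nat \<Rightarrow> nat \<Rightarrow> nat \<Rightarrow> nat \<Rightarrow> bool"
  where "symmetric_pattern r n i j \<longleftrightarrow>
    (if r = 1 then i = j else i + j + 1 = n \<or> i + j + 2 = n \<or> i + 1 = n \<and> j + 1 = n)"

lemma symmetric_pattern_commute: "symmetric_pattern r n i j \<longleftrightarrow> symmetric_pattern r n j i"
  by (auto simp: symmetric_pattern_def)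

context right_regular_multigraph
begin

text \<open>
  The marked entries of the load matrix are those where the load is \<open>m + s\<close> instead of \<open>m\<close>. Keeping
  the sign \<open>s\<close> as a parameter treats degrees just above and just below a multiple of
  the number of colours at once.
\<close>

definition two_valued :: "int \<Rightarrow> int \<Rightarrow> ('e \<Rightarrow> 'k) \<Rightarrow> ('l \<Rightarrow> 'k \<Rightarrow> bool) \<Rightarrow> bool"
  where "two_valued m s c M \<longleftrightarrow>
    right_proper c \<and> (\<forall>x\<in>L. \<forall>a\<in>K. int (load c x a) = m + s * of_bool (M x a))"

text \<open>
  In an equitable colouring the rescaled deviations \<open>s * (load c x a - m)\<close> of a row differ by at most one
  and sum up to \<open>r\<close>, which is nonnegative and less than their number; so they are 0 or 1.
\<close>

lemma ex_two_valued:
  assumes s: "s = 1 \<or> s = -1"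
    and deg: "\<And>x. x \<in> L \<Longrightarrow> int (card {e \<in> E. u e = x}) = m * int (card K) + s * int r"
    and r: "r < card K"
  shows "\<exists>c M. two_valued m s c M"
proof -
  obtain c where c: "right_proper c"
    and eq: "\<And>x a b. x \<in> L \<Longrightarrow> a \<in> K \<Longrightarrow> b \<in> K \<Longrightarrow> load c x a \<le> load c x b + 1"
    using ex_equitable by auto
  define g where "g x a = s * (int (load c x a) - m)" for x a
  have ss: "s * s = 1" using s by auto
  have g01: "g x a = 0 \<or> g x a = 1" if x: "x \<in> L" and a: "a \<in> K" for x a
  proof (rule balanced_zero_one[OF finite_K _ _ r a, of "g x"])
    fix a b assume "a \<in> K" "b \<in> K"
    then show "g x a \<le> g x b + 1"
      using s eq[OF x, of a b] eq[OF x, of b a] by (auto simp: g_def)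
  next
    have "(\<Sum>a\<in>K. int (load c x a)) = m * int (card K) + s * int r"
      using row_sum[OF c, of x] deg[OF x] by (simp flip: of_nat_sum)
    then have "(\<Sum>a\<in>K. g x a) = s * (s * int r)"
      by (simp add: g_def sum_subtractf flip: sum_distrib_left)
    then show "(\<Sum>a\<in>K. g x a) = int r" using ss by (simp flip: mult.assoc)
  qed
  have "int (load c x a) = m + s * g x a" for x a
    using ss by (simp add: g_def flip: mult.assoc)
  then have "two_valued m s c (\<lambda>x a. g x a = 1)"
    using c g01 by (force simp: two_valued_def)
  then show ?thesis by blast
qed

lemma two_valued_row:
  assumes M: "two_valued m s c M" and s: "s = 1 \<or> s = -1" and x: "x \<in> L"
    and deg: "int (card {e \<in> E. u e = x}) = m * int (card K) + s * int r"
  shows "card {a \<in> K. M x a} = r"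
proof -
  have "right_proper c" using M by (simp add: two_valued_def)
  from row_sum[OF this] have "int (card {e \<in> E. u e = x}) = (\<Sum>a\<in>K. int (load c x a))"
    by (simp flip: of_nat_sum)
  also have "\<dots> = (\<Sum>a\<in>K. m + s * of_bool (M x a))"
    using M x by (simp add: two_valued_def)
  also have "\<dots> = m * int (card K) + s * int (card {a \<in> K. M x a})"
    using finite_K by (simp add: sum.distrib flip: sum_distrib_left) (simp add: Int_def)
  finally show ?thesis using deg s by auto
qed

lemma two_valued_column:
  assumes M: "two_valued m s c M" and s: "s = 1 \<or> s = -1" and a: "a \<in> K"
    and deg: "int (card R) = m * int (card L) + s * int r"
  shows "card {x \<in> L. M x a} = r"
proof -
  have "right_proper c" using M by (simp add: two_valued_def)
  from column_sum[OF this a] have "int (card R) = (\<Sum>x\<in>L. int (load c x a))"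
    by (simp flip: of_nat_sum)
  also have "\<dots> = (\<Sum>x\<in>L. m + s * of_bool (M x a))"
    using M a by (simp add: two_valued_def)
  also have "\<dots> = m * int (card L) + s * int (card {x \<in> L. M x a})"
    using finite_L by (simp add: sum.distrib flip: sum_distrib_left) (simp add: Int_def)
  finally show ?thesis using deg s by auto
qed

text \<open>
  An exchange applied to a marked and an unmarked entry of a row again gives a two-valued colouring. For
  \<open>s = -1\<close> a mark means a smaller load, so the two colours change roles.
\<close>

lemma two_valued_switch:
  assumes M: "two_valued m s c M" and s: "s = 1 \<or> s = -1"
    and x: "x \<in> L" and a: "a \<in> K" and b: "b \<in> K" and xa: "M x a" and xb: "\<not> M x b"
  shows "\<exists>x'\<in>L. \<not> M x' a \<and> M x' b \<and> (\<exists>c'. two_valued m s c' (switch M x a x' b))"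
proof -
  have c: "right_proper c" and val: "\<And>x a. x \<in> L \<Longrightarrow> a \<in> K \<Longrightarrow> int (load c x a) = m + s * of_bool (M x a)"
    using M by (auto simp: two_valued_def)
  have "\<exists>x' c'. right_proper c' \<and> x' \<in> L \<and> \<not> M x' a \<and> M x' b \<and>
    (\<forall>z d. int (load c' z d) = int (load c z d)
        + s * ((of_bool (z = x') - of_bool (z = x)) * (of_bool (d = a) - of_bool (d = b))))"
  proof (cases "s = 1")
    case True
    have "load c x b < load c x a" using val[OF x a] val[OF x b] xa xb True by simp
    from exchange[OF c a b this] obtain x' c' where c': "right_proper c'" "x' \<in> L"
      and less: "load c x' a < load c x' b"
      and upd: "\<forall>z d. int (load c' z d) = int (load c z d)
        + (of_bool (z = x') - of_bool (z = x)) * (of_bool (d = a) - of_bool (d = b))" by (elim exE conjE)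
    have "\<not> M x' a \<and> M x' b"
      using less val[OF c'(2) a] val[OF c'(2) b] True by (cases "M x' a"; cases "M x' b") auto
    then show ?thesis using c' upd True by (intro exI[of _ x'] exI[of _ c']) simp
  next
    case False
    then have neg: "s = -1" using s by simp
    have "load c x a < load c x b" using val[OF x a] val[OF x b] xa xb neg by simp
    from exchange[OF c b a this] obtain x' c' where c': "right_proper c'" "x' \<in> L"
      and less: "load c x' b < load c x' a"
      and upd: "\<forall>z d. int (load c' z d) = int (load c z d)
        + (of_bool (z = x') - of_bool (z = x)) * (of_bool (d = b) - of_bool (d = a))" by (elim exE conjE)
    have "\<not> M x' a \<and> M x' b"
      using less val[OF c'(2) a] val[OF c'(2) b] neg by (cases "M x' a"; cases "M x' b") auto
    then show ?thesis using c' upd neg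
      by (intro exI[of _ x'] exI[of _ c']) (simp add: algebra_simps)
  qed
  then obtain x' c' where c': "right_proper c'" and x': "x' \<in> L" "\<not> M x' a" "M x' b"
    and upd: "\<And>z d. int (load c' z d) = int (load c z d)
        + s * ((of_bool (z = x') - of_bool (z = x)) * (of_bool (d = a) - of_bool (d = b)))"
    by (elim exE conjE) simp
  have ne: "x \<noteq> x'" "a \<noteq> b" using x' xa xb by auto
  have "int (load c' z d) = m + s * of_bool (switch M x a x' b z d)" if "z \<in> L" "d \<in> K" for z d
    unfolding upd val[OF that] using ne xa xb x'
    by (cases "d = a"; cases "d = b"; cases "z = x"; cases "z = x'") (simp_all add: switch_def)
  then have "two_valued m s c' (switch M x a x' b)" using c' by (simp add: two_valued_def)
  then show ?thesis using x' by blast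
qed

lemma ex_normal_form:
  assumes s: "s = 1 \<or> s = -1"
    and deg: "\<And>x. x \<in> L \<Longrightarrow> int (card {e \<in> E. u e = x}) = m * int n + s * int r"
    and cards: "card L = n" "card K = n" "int (card R) = m * int n + s * int r"
    and r: "r = 1 \<or> r = 2" "r < n"
  shows "\<exists>c f g. right_proper c \<and> bij_betw f {..<n} L \<and> bij_betw g {..<n} K \<and>
    (\<forall>i<n. \<forall>j<n. int (load c (f i) (g j)) = m + s * of_bool (symmetric_pattern r n i j))"
proof -
  obtain c M where M: "two_valued m s c M"
    using ex_two_valued[OF s, of m r] deg cards r by auto
  have rows: "card {a \<in> K. M' x a} = r" if "two_valued m s c' M'" "x \<in> L" for c' M' x
    using two_valued_row[OF that(1) s that(2)] deg[OF that(2)] cards by simp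
  have cols: "card {x \<in> L. M' x a} = r" if "two_valued m s c' M'" "a \<in> K" for c' M' a
    using two_valued_column[OF that(1) s that(2)] cards by simp
  have "\<exists>c M f g. two_valued m s c M \<and> bij_betw f {..<n} L \<and> bij_betw g {..<n} K \<and>
    (\<forall>i<n. \<forall>j<n. M (f i) (g j) \<longleftrightarrow> symmetric_pattern r n i j)"
  proof (cases "r = 1")
    case True
    have "\<exists>f g. bij_betw f {..<n} L \<and> bij_betw g {..<n} K \<and>
      (\<forall>i<n. \<forall>j<n. M (f i) (g j) \<longleftrightarrow> i = j)"
      using rows[OF M] cols[OF M] True
      by (intro ex_diagonal_enumeration[OF finite_L finite_K cards(1,2)]) simp_all
    then obtain f g where "bij_betw f {..<n} L" "bij_betw g {..<n} K"
      "\<forall>i<n. \<forall>j<n. M (f i) (g j) \<longleftrightarrow> i = j" by (elim exE conjE)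
    then show ?thesis using M True
      by (intro exI[of _ c] exI[of _ M] exI[of _ f] exI[of _ g]) (simp add: symmetric_pattern_def)
  next
    case False
    then have r2: "r = 2" and n3: "n \<ge> 3" using r by auto
    have "\<exists>M f g. (\<exists>c. two_valued m s c M) \<and> bij_betw f {..<n} L \<and> bij_betw g {..<n} K \<and>
      (\<forall>i<n. \<forall>j<n. M (f i) (g j) \<longleftrightarrow> i = j \<or> i = Suc j mod n)"
    proof (rule ex_single_cycle[OF finite_L finite_K cards(1,2) n3])
      show "\<exists>c. two_valued m s c M" using M by blast
      show "two_regular L K M'" if "\<exists>c. two_valued m s c M'" for M'
        using that rows cols r2 by (auto simp: two_regular_def)
      show "\<exists>x'\<in>L. \<not> M' x' a \<and> M' x' b \<and> (\<exists>c'. two_valued m s c' (switch M' x a x' b))"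
        if "\<exists>c. two_valued m s c M'" "x \<in> L" "a \<in> K" "b \<in> K" "M' x a" "\<not> M' x b" for M' x a b
        using that two_valued_switch[OF _ s] by blast
    qed
    then obtain M f g c where Mc: "two_valued m s c M" and f: "bij_betw f {..<n} L"
      and g: "bij_betw g {..<n} K"
      and Mfg: "\<forall>i<n. \<forall>j<n. M (f i) (g j) \<longleftrightarrow> i = j \<or> i = Suc j mod n" by (elim exE conjE)
    \<comment> \<open>Enumerating the rows backwards makes the cycle symmetric.\<close>
    have refl: "bij_betw (\<lambda>i. n - 1 - i) {..<n} {..<n}"
      by (rule bij_betw_byWitness[of _ "\<lambda>i. n - 1 - i"]) auto
    have "M ((f \<circ> (\<lambda>i. n - 1 - i)) i) (g j) \<longleftrightarrow> symmetric_pattern r n i j" if "i < n" "j < n" for i j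
    proof -
      have "M (f (n - 1 - i)) (g j) \<longleftrightarrow> n - 1 - i = j \<or> n - 1 - i = Suc j mod n"
        using Mfg that by simp
      also have "\<dots> \<longleftrightarrow> symmetric_pattern r n i j"
        using that n3 r2 by (cases "Suc j = n") (auto simp: symmetric_pattern_def)
      finally show ?thesis by simp
    qed
    then show ?thesis using Mc g bij_betw_trans[OF refl f]
      by (intro exI[of _ c] exI[of _ M] exI[of _ "f \<circ> (\<lambda>i. n - 1 - i)"] exI[of _ g]) simp
  qed
  then obtain c M f g where Mc: "two_valued m s c M" and fg: "bij_betw f {..<n} L" "bij_betw g {..<n} K"
    and Mfg: "\<forall>i<n. \<forall>j<n. M (f i) (g j) \<longleftrightarrow> symmetric_pattern r n i j" by (elim exE conjE)
  have "int (load c (f i) (g j)) = m + s * of_bool (symmetric_pattern r n i j)" if "i < n" "j < n" for i j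
    using Mc Mfg that bij_betw_apply[OF fg(1), of i] bij_betw_apply[OF fg(2), of j]
    by (simp add: two_valued_def)
  moreover have "right_proper c" using Mc by (simp add: two_valued_def)
  ultimately show ?thesis using fg by (intro exI[of _ c] exI[of _ f] exI[of _ g]) simp
qed

end

section \<open>Two graphs that colour each other\<close>

lemma (in biregular_multigraph) card_left_times_degree:
  assumes "x \<in> L" shows "card L * card {e \<in> E. u e = x} = card E"
proof -
  have "card E = card (\<Union>x'\<in>L. {e \<in> E. u e = x'})"
    using u_in by (intro arg_cong[of _ _ card]) auto
  also have "\<dots> = (\<Sum>x'\<in>L. card {e \<in> E. u e = x'})"
    by (intro card_UN_disjoint finite_L) (auto simp: finite_E)
  also have "\<dots> = (\<Sum>x'\<in>L. card {e \<in> E. u e = x})"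
    by (rule sum.cong[OF refl left_regular[OF _ assms]])
  finally show ?thesis by simp
qed

lemma (in biregular_multigraph) card_right_times_degree:
  assumes "y \<in> R" shows "card R * card {e \<in> E. v e = y} = card E"
proof -
  have "card E = card (\<Union>y'\<in>R. {e \<in> E. v e = y'})"
    using v_in by (intro arg_cong[of _ _ card]) auto
  also have "\<dots> = (\<Sum>y'\<in>R. card {e \<in> E. v e = y'})"
    by (intro card_UN_disjoint finite_R) (auto simp: finite_E)
  also have "\<dots> = (\<Sum>y'\<in>R. card {e \<in> E. v e = y})"
    by (rule sum.cong[OF refl right_regular[OF _ assms]])
  finally show ?thesis by simp
qed

locale mutually_colored_pair =
  G1: right_regular_multigraph L1 R1 E1 u1 v1 L2 + G2: right_regular_multigraph L2 R2 E2 u2 v2 L1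
  for L1 :: "'l1 set" and R1 :: "'r1 set" and E1 :: "'e1 set"
    and u1 :: "'e1 \<Rightarrow> 'l1" and v1 :: "'e1 \<Rightarrow> 'r1"
    and L2 :: "'l2 set" and R2 :: "'r2 set" and E2 :: "'e2 set"
    and u2 :: "'e2 \<Rightarrow> 'l2" and v2 :: "'e2 \<Rightarrow> 'r2"
begin

definition transposed_colorings :: "('e1 \<Rightarrow> 'l2) \<Rightarrow> ('e2 \<Rightarrow> 'l1) \<Rightarrow> bool"
  where "transposed_colorings p q \<longleftrightarrow> G1.right_proper p \<and> G2.right_proper q \<and>
    (\<forall>x\<in>L1. \<forall>z\<in>L2. G1.load p x z = G2.load q z x)"

text \<open>
  Equality of the loads says that the maps \<open>(u1, p)\<close> on \<open>E1\<close> and \<open>(q, u2)\<close> on \<open>E2\<close> have fibres of equal size,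
  so some bijection carries one to the other. It turns \<open>u2\<close> into \<open>p\<close> and
  \<open>u1\<close> into \<open>q\<close>.
\<close>

lemma bijection_of_transposed_colorings:
  assumes pq: "transposed_colorings p q"
  shows "\<exists>\<psi>. bij_betw \<psi> E1 E2
           \<and> pair_matrix L2 R1 E1 (u2 \<circ> \<psi>) v1 = ones_matrix L2 R1
           \<and> pair_matrix L1 R2 E2 (u1 \<circ> inv_into E1 \<psi>) v2 = ones_matrix L1 R2"
proof -
  have p: "G1.right_proper p" and q: "G2.right_proper q"
    and loads: "\<And>x z. x \<in> L1 \<Longrightarrow> z \<in> L2 \<Longrightarrow> G1.load p x z = G2.load q z x"
    using pq by (simp_all add: transposed_colorings_def)
  have "card {e \<in> E1. (u1 e, p e) = (x, z)} = card {e \<in> E2. (q e, u2 e) = (x, z)}" for x z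
  proof (cases "x \<in> L1 \<and> z \<in> L2")
    case True
    then show ?thesis using loads[of x z] by (simp add: G1.load_def G2.load_def conj_commute)
  next
    case False
    then have "{e \<in> E1. (u1 e, p e) = (x, z)} = {}" "{e \<in> E2. (q e, u2 e) = (x, z)} = {}"
      using G1.u_in G2.u_in G1.color_in[OF p] G2.color_in[OF q] by auto
    then show ?thesis by (simp only: card.empty)
  qed
  then have "card {e \<in> E1. (u1 e, p e) = w} = card {e \<in> E2. (q e, u2 e) = w}" for w
    by (cases w) simp
  from ex_bij_fibrewise[OF G1.finite_E G2.finite_E this]
  obtain \<psi> where \<psi>: "bij_betw \<psi> E1 E2"
    and fib: "\<forall>e\<in>E1. (q (\<psi> e), u2 (\<psi> e)) = (u1 e, p e)" by (elim exE conjE)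
  have u2_\<psi>: "u2 (\<psi> e) = p e" and q_\<psi>: "q (\<psi> e) = u1 e" if "e \<in> E1" for e
    using bspec[OF fib that] by simp_all
  have inv: "u1 (inv_into E1 \<psi> e) = q e" if "e \<in> E2" for e
    using q_\<psi>[of "inv_into E1 \<psi> e"] bij_betw_inv_into_right[OF \<psi> that]
      bij_betw_apply[OF bij_betw_inv_into[OF \<psi>] that] by simp
  have "pair_matrix L2 R1 E1 (u2 \<circ> \<psi>) v1 = pair_matrix L2 R1 E1 p v1"
    unfolding pair_matrix_def by (simp add: u2_\<psi> cong: conj_cong)
  moreover have "pair_matrix L1 R2 E2 (u1 \<circ> inv_into E1 \<psi>) v2 = pair_matrix L1 R2 E2 q v2"
    unfolding pair_matrix_def by (simp add: inv cong: conj_cong)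
  ultimately show ?thesis
    using \<psi> G1.pair_matrix_right_proper[OF p] G2.pair_matrix_right_proper[OF q]
    by (intro exI[of _ \<psi>]) simp
qed

lemma ex_transposed_colorings_of_multiple:
  assumes ne: "L1 \<noteq> {}" "L2 \<noteq> {}"
    and deg1: "\<And>x. x \<in> L1 \<Longrightarrow> card {e \<in> E1. u1 e = x} = m * card L2"
    and deg2: "\<And>z. z \<in> L2 \<Longrightarrow> card {e \<in> E2. u2 e = z} = m * card L1"
  shows "\<exists>p q. transposed_colorings p q"
proof -
  have pos: "0 < card L1" "0 < card L2" using ne G1.finite_L G2.finite_L by (simp_all add: card_gt_0_iff)
  obtain p M where p: "G1.two_valued (int m) 1 p M"
    using G1.ex_two_valued[of 1 "int m" 0] deg1 pos by auto
  obtain q N where q: "G2.two_valued (int m) 1 q N"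
    using G2.ex_two_valued[of 1 "int m" 0] deg2 pos by auto
  have "G1.load p x z = G2.load q z x" if x: "x \<in> L1" and z: "z \<in> L2" for x z
  proof -
    have "card {a \<in> L2. M x a} = 0" using G1.two_valued_row[OF p _ x, of 0] deg1[OF x] by simp
    moreover have "card {a \<in> L1. N z a} = 0" using G2.two_valued_row[OF q _ z, of 0] deg2[OF z] by simp
    ultimately have "\<not> M x z" "\<not> N z x" using x z G1.finite_L G2.finite_L by auto
    then have "int (G1.load p x z) = int m" "int (G2.load q z x) = int m"
      using p q x z by (simp_all add: G1.two_valued_def G2.two_valued_def)
    then show ?thesis by simp
  qed
  then show ?thesis using p q
    by (intro exI[of _ p] exI[of _ q]) (simp add: G1.two_valued_def G2.two_valued_def transposed_colorings_def)
qed

text \<open>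
  Each graph is brought to normal form separately, with enumerations \<open>f1, g1\<close> and \<open>f2, g2\<close> of its left
  vertices and of its colours. The colours of each graph are then renamed so that their enumeration becomes the one
  of the left vertices of the other graph; transposition turns into the
  symmetry of the pattern.
\<close>

lemma ex_transposed_colorings_near_multiple:
  assumes cards: "card L1 = n" "card L2 = n" "card R1 = k" "card R2 = k"
    and deg1: "\<And>x. x \<in> L1 \<Longrightarrow> card {e \<in> E1. u1 e = x} = k"
    and deg2: "\<And>z. z \<in> L2 \<Longrightarrow> card {e \<in> E2. u2 e = z} = k"
    and k: "int k = m * int n + s * int r" "s = 1 \<or> s = -1" "r = 1 \<or> r = 2" "r < n"
  shows "\<exists>p q. transposed_colorings p q"
proof -
  let ?val = "\<lambda>i j. m + s * of_bool (symmetric_pattern r n i j)"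
  have "\<exists>c f g. G1.right_proper c \<and> bij_betw f {..<n} L1 \<and> bij_betw g {..<n} L2 \<and>
    (\<forall>i<n. \<forall>j<n. int (G1.load c (f i) (g j)) = ?val i j)"
    using k deg1 cards by (intro G1.ex_normal_form) simp_all
  then obtain c1 f1 g1 where c1: "G1.right_proper c1" and f1: "bij_betw f1 {..<n} L1"
    and g1: "bij_betw g1 {..<n} L2"
    and load1: "\<forall>i<n. \<forall>j<n. int (G1.load c1 (f1 i) (g1 j)) = ?val i j" by (elim exE conjE)
  have "\<exists>c f g. G2.right_proper c \<and> bij_betw f {..<n} L2 \<and> bij_betw g {..<n} L1 \<and>
    (\<forall>i<n. \<forall>j<n. int (G2.load c (f i) (g j)) = ?val i j)"
    using k deg2 cards by (intro G2.ex_normal_form) simp_all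
  then obtain c2 f2 g2 where c2: "G2.right_proper c2" and f2: "bij_betw f2 {..<n} L2"
    and g2: "bij_betw g2 {..<n} L1"
    and load2: "\<forall>i<n. \<forall>j<n. int (G2.load c2 (f2 i) (g2 j)) = ?val i j" by (elim exE conjE)
  define h1 where "h1 = f2 \<circ> inv_into {..<n} g1"
  define h2 where "h2 = f1 \<circ> inv_into {..<n} g2"
  have h1: "bij_betw h1 L2 L2" and h2: "bij_betw h2 L1 L1"
    unfolding h1_def h2_def using f1 f2 g1 g2 by (auto intro: bij_betw_trans bij_betw_inv_into)
  have load1': "int (G1.load (h1 \<circ> c1) (f1 i) (f2 j)) = ?val i j" if "i < n" "j < n" for i j
  proof -
    have "h1 (g1 j) = f2 j" using that bij_betw_inv_into_left[OF g1] by (simp add: h1_def)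
    then show ?thesis
      using G1.load_recolor[OF c1 h1, of "g1 j" "f1 i"] bij_betw_apply[OF g1, of j] load1 that by simp
  qed
  have load2': "int (G2.load (h2 \<circ> c2) (f2 j) (f1 i)) = ?val j i" if "i < n" "j < n" for i j
  proof -
    have "h2 (g2 i) = f1 i" using that bij_betw_inv_into_left[OF g2] by (simp add: h2_def)
    then show ?thesis
      using G2.load_recolor[OF c2 h2, of "g2 i" "f2 j"] bij_betw_apply[OF g2, of i] load2 that by simp
  qed
  have "G1.load (h1 \<circ> c1) x z = G2.load (h2 \<circ> c2) z x" if "x \<in> L1" "z \<in> L2" for x z
  proof -
    obtain i where i: "i < n" "x = f1 i" using bij_betw_imp_surj_on[OF f1] \<open>x \<in> L1\<close> by auto
    obtain j where j: "j < n" "z = f2 j" using bij_betw_imp_surj_on[OF f2] \<open>z \<in> L2\<close> by auto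
    have "int (G1.load (h1 \<circ> c1) x z) = int (G2.load (h2 \<circ> c2) z x)"
      using load1'[of i j] load2'[of i j] i j symmetric_pattern_commute[of r n i j] by simp
    then show ?thesis by simp
  qed
  then show ?thesis using G1.right_proper_recolor[OF c1 h1] G2.right_proper_recolor[OF c2 h2]
    by (intro exI[of _ "h1 \<circ> c1"] exI[of _ "h2 \<circ> c2"]) (simp add: transposed_colorings_def)
qed

end

theorem theorem3:
  fixes n1 k1 n2 k2 :: nat
    and L1 :: "'l1 set" and R1 :: "'r1 set" and E1 :: "'e1 set"
    and u1 :: "'e1 \<Rightarrow> 'l1" and v1 :: "'e1 \<Rightarrow> 'r1"
    and L2 :: "'l2 set" and R2 :: "'r2 set" and E2 :: "'e2 set"
    and u2 :: "'e2 \<Rightarrow> 'l2" and v2 :: "'e2 \<Rightarrow> 'r2"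
  assumes "n1 > 0" and "k1 > 0" and "n2 > 0" and "k2 > 0"
    and "n1 * k2 = n2 * k1"
    and "(n1 = n2 \<and> k1 = k2 \<and>
           (\<exists>m::nat. \<exists>\<epsilon>::int. m \<ge> 1 \<and> \<epsilon> \<in> {-2, -1, 0, 1, 2} \<and>
              int k1 = int m * int n1 + \<epsilon>))
         \<or> n1 dvd k1"
    and "card L1 = n1" and "card R1 = k1" and "card L2 = n2" and "card R2 = k2"
    and "biregular_multigraph L1 R1 E1 u1 v1"
    and "biregular_multigraph L2 R2 E2 u2 v2"
    and "card E1 = n1 * k2" and "card E2 = n1 * k2"
  shows "\<exists>\<psi>. bij_betw \<psi> E1 E2
           \<and> pair_matrix L2 R1 E1 (u2 \<circ> \<psi>) v1 = ones_matrix L2 R1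
           \<and> pair_matrix L1 R2 E2 (u1 \<circ> inv_into E1 \<psi>) v2 = ones_matrix L1 R2"
proof -
  interpret B1: biregular_multigraph L1 R1 E1 u1 v1 by fact
  interpret B2: biregular_multigraph L2 R2 E2 u2 v2 by fact
  have left1: "card {e \<in> E1. u1 e = x} = k2" if "x \<in> L1" for x
  proof -
    have "n1 * card {e \<in> E1. u1 e = x} = n1 * k2" using B1.card_left_times_degree[OF that] assms(7,13) by simp
    then show ?thesis using assms(1) by simp
  qed
  have left2: "card {e \<in> E2. u2 e = x} = k1" if "x \<in> L2" for x
  proof -
    have "n2 * card {e \<in> E2. u2 e = x} = n2 * k1" using B2.card_left_times_degree[OF that] assms(5,9,14) by simp
    then show ?thesis using assms(3) by simp
  qed
  have right1: "card {e \<in> E1. v1 e = y} = card L2" if "y \<in> R1" for y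
  proof -
    have "k1 * card {e \<in> E1. v1 e = y} = k1 * n2"
      using B1.card_right_times_degree[OF that] assms(5,8,13) by (simp add: mult.commute)
    then show ?thesis using assms(2,9) by simp
  qed
  have right2: "card {e \<in> E2. v2 e = y} = card L1" if "y \<in> R2" for y
  proof -
    have "k2 * card {e \<in> E2. v2 e = y} = k2 * n1"
      using B2.card_right_times_degree[OF that] assms(10,14) by (simp add: mult.commute)
    then show ?thesis using assms(4,7) by simp
  qed
  interpret P: mutually_colored_pair L1 R1 E1 u1 v1 L2 R2 E2 u2 v2
    using right1 right2 B1.finite_L B2.finite_L by unfold_locales
  have "\<exists>p q. P.transposed_colorings p q"
  proof (cases "n1 dvd k1")
    case True
    then obtain m where m: "k1 = m * n1" by (auto simp: dvd_def mult.commute)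
    then have "k2 = m * n2" using \<open>n1 * k2 = n2 * k1\<close> \<open>n1 > 0\<close> by simp
    then show ?thesis using m left1 left2 assms(1,3,7,9)
      by (intro P.ex_transposed_colorings_of_multiple[of m]) auto
  next
    case False
    then obtain m :: nat and \<epsilon> :: int where nk: "n1 = n2" "k1 = k2"
      and \<epsilon>: "\<epsilon> \<in> {-2, -1, 0, 1, 2}" "int k1 = int m * int n1 + \<epsilon>" using assms(6) by auto
    \<comment> \<open>A multiple of \<open>n1\<close> was treated above; this excludes \<open>\<epsilon> = 0\<close> and the small \<open>n1\<close> with \<open>n1 \<le> \<bar>\<epsilon>\<bar>\<close>.\<close>
    have ndvd: "\<not> int n1 dvd \<epsilon>"
    proof
      assume "int n1 dvd \<epsilon>"
      then have "int n1 dvd int k1" using \<epsilon>(2) by simp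
      then show False using False by simp
    qed
    have "\<epsilon> = sgn \<epsilon> * int (nat \<bar>\<epsilon>\<bar>)" by (simp add: sgn_mult_abs)
    then have "int k1 = int m * int n1 + sgn \<epsilon> * int (nat \<bar>\<epsilon>\<bar>)" using \<epsilon>(2) by simp
    moreover have "sgn \<epsilon> = 1 \<or> sgn \<epsilon> = -1" "nat \<bar>\<epsilon>\<bar> = 1 \<or> nat \<bar>\<epsilon>\<bar> = 2"
      using \<epsilon>(1) ndvd by auto
    moreover have "nat \<bar>\<epsilon>\<bar> < n1"
    proof (rule ccontr)
      assume "\<not> ?thesis"
      then have "n1 = 1 \<or> n1 = 2 \<and> \<bar>\<epsilon>\<bar> = 2" using \<epsilon>(1) ndvd \<open>n1 > 0\<close> by auto
      then show False using ndvd \<epsilon>(1) by auto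
    qed
    ultimately show ?thesis using left1 left2 nk assms(7-10)
      by (intro P.ex_transposed_colorings_near_multiple[of n1 k1 "int m" "sgn \<epsilon>" "nat \<bar>\<epsilon>\<bar>"]) simp_all
  qed
  then show ?thesis using P.bijection_of_transposed_colorings by (elim exE)
qed

end
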